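(* Let $\alpha>-1$, $1<p\le\infty$ and $q=p/(p-1)$ ($q=1$ if $p=\infty$). For every $f^\ast\in L^p(\mathbb{T})$ and $f=P_\alpha[f^\ast]$, $$|Df(0)|\le\frac{(2+\alpha)\Gamma\!\left(1+\frac{\alpha}{2}\right)^2}{\Gamma(1+\alpha)}\left(\frac{\Gamma\!\left(\frac{1+q}{2}\right)}{\sqrt{\pi}\,\Gamma\!\left(\frac{2+q}{2}\right)}\right)^{1/q}\|f^\ast\|_p,$$ and the constant is best possible.
   Context: $\mathbb{D}$ is the open unit disk, $\mathbb{T}=\partial\mathbb{D}$. For $\alpha>-1$ let $c_\alpha=\frac{\Gamma(1+\alpha/2)^2}{\Gamma(1+\alpha)}$ and $K_\alpha(z)=c_\alpha\frac{(1-|z|^2)^{\alpha+1}}{|1-z|^{\alpha+2}}$. For $f^\ast\in L^1(\mathbb{T})$, $P_\alpha[f^\ast](z)=\frac{1}{2\pi}\int_0^{2\pi}K_\alpha(ze^{-it})f^\ast(e^{it})\,dt$ is the $\alpha$-harmonic function with boundary values $f^\ast$. Norms are normalized: $\|g\|_p=\left(\int_0^{2\pi}|g(e^{it})|^p\frac{dt}{2\pi}\right)^{1/p}$, $\|g\|_\infty$ the essential supremum. For $w=u+iv$, $|Dw(z)|$ is the operator norm of the real Jacobian $\begin{pmatrix}u_x&u_y\\ v_x&v_y\end{pmatrix}$, equal to $|w_z|+|w_{\bar z}|$. *)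

theory Defs
  imports "HOL-Analysis.Analysis" "HOL-Probability.Essential_Supremum"
begin

text \<open>Boundary functions f* on the unit circle are represented as functions
  g :: real \<Rightarrow> complex, where g t stands for f*(e^{it}); only the values on [0, 2 pi] matter.\<close>

definition c_alpha :: "real \<Rightarrow> real" where
  "c_alpha \<alpha> = Gamma (1 + \<alpha> / 2) ^ 2 / Gamma (1 + \<alpha>)"

definition K_alpha :: "real \<Rightarrow> complex \<Rightarrow> real" where
  "K_alpha \<alpha> z = c_alpha \<alpha> * (1 - (cmod z)\<^sup>2) powr (\<alpha> + 1) / (cmod (1 - z)) powr (\<alpha> + 2)"

definition P_alpha :: "real \<Rightarrow> (real \<Rightarrow> complex) \<Rightarrow> complex \<Rightarrow> complex" where
  "P_alpha \<alpha> g z = complex_of_real (1 / (2 * pi)) *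
     (LINT t:{0..2*pi}|lborel. complex_of_real (K_alpha \<alpha> (z * cis (- t))) * g t)"

definition in_Lp :: "ereal \<Rightarrow> (real \<Rightarrow> complex) \<Rightarrow> bool" where
  "in_Lp p g \<longleftrightarrow> set_borel_measurable lborel {0..2*pi} g \<and>
     (if p = \<infinity> then esssup (restrict_space lborel {0..2*pi}) (\<lambda>t. ereal (cmod (g t))) < \<infinity>
      else (\<integral>\<^sup>+ t \<in> {0..2*pi}. ennreal (cmod (g t) powr real_of_ereal p) \<partial>lborel) < \<infinity>)"

definition Lp_norm :: "ereal \<Rightarrow> (real \<Rightarrow> complex) \<Rightarrow> real" where
  "Lp_norm p g =
     (if p = \<infinity> then real_of_ereal (esssup (restrict_space lborel {0..2*pi}) (\<lambda>t. ereal (cmod (g t))))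
      else (enn2real (\<integral>\<^sup>+ t \<in> {0..2*pi}. ennreal (cmod (g t) powr real_of_ereal p) \<partial>lborel) / (2 * pi))
             powr (1 / real_of_ereal p))"

definition conj_exp :: "ereal \<Rightarrow> real" where
  "conj_exp p = (if p = \<infinity> then 1 else real_of_ereal p / (real_of_ereal p - 1))"

definition Dnorm0 :: "(complex \<Rightarrow> complex) \<Rightarrow> real" where
  "Dnorm0 f = onorm (frechet_derivative f (at 0))"

definition sharp_const :: "real \<Rightarrow> real \<Rightarrow> real" where
  "sharp_const \<alpha> q = (2 + \<alpha>) * Gamma (1 + \<alpha> / 2) ^ 2 / Gamma (1 + \<alpha>) *
     (Gamma ((1 + q) / 2) / (sqrt pi * Gamma ((2 + q) / 2))) powr (1 / q)"

end

theory Submission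
  imports Defs
begin

text \<open>
  Since \<open>K_alpha \<alpha> z = c_alpha \<alpha> * (1 + (\<alpha> + 2) * Re z) + o(z)\<close> and rotations preserve the modulus,
  the remainder is uniform in the angle, so \<open>f = P_alpha \<alpha> g\<close> is differentiable at 0 with
  \<open>Df(0) h\<close> equal to \<open>c_alpha \<alpha> * (\<alpha> + 2)\<close> times the mean of \<open>Re (h * cis (- t)) * g t\<close>.
  For \<open>h = \<bar>h\<bar> * cis s\<close> the kernel is \<open>\<bar>h\<bar> * cos (t - s)\<close>, and Hoelder's inequality gives the bound;
  the mean of \<open>\<bar>cos\<bar> powr q\<close> is a Beta integral.
  Equality holds for \<open>g t = sgn (cos t) * \<bar>cos t\<bar> powr (q - 1)\<close>, the equality case of Hoelder at \<open>h = 1\<close>.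
\<close>

section \<open>The kernel near the origin\<close>

text \<open>The factor \<open>(1 - (cmod z)\<^sup>2) powr (\<alpha> + 1)\<close> is stationary at 0,
  so the linear term comes only from the power of \<open>cmod (1 - z)\<close>. The coordinates
  \<open>Re z\<close> and \<open>Im z\<close> are used because the norm itself is not differentiable
  at 0, although its square is.\<close>

lemma K_alpha_has_derivative_0:
  "(K_alpha \<alpha> has_derivative (\<lambda>h. c_alpha \<alpha> * (\<alpha> + 2) * Re h)) (at 0)"
proof -
  have "((\<lambda>z. c_alpha \<alpha> * (1 - ((Re z)\<^sup>2 + (Im z)\<^sup>2)) powr (\<alpha> + 1) /
      (sqrt ((1 - Re z)\<^sup>2 + (Im z)\<^sup>2)) powr (\<alpha> + 2)) has_derivative
      (\<lambda>h. c_alpha \<alpha> * (\<alpha> + 2) * Re h)) (at 0)"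
    by (auto intro!: derivative_eq_intros simp: fun_eq_iff algebra_simps)
  then show ?thesis
    by (simp add: K_alpha_def [abs_def] cmod_def)
qed

lemma borel_measurable_K_alpha [measurable]: "K_alpha \<alpha> \<in> borel_measurable borel"
  unfolding K_alpha_def [abs_def] by measurable

section \<open>Hoelder's inequality\<close>

text \<open>Young's inequality, applied pointwise, already shows that the product is integrable.
  Applied to \<open>f\<close> and \<open>g\<close> divided by their norms and then integrated, it
  gives the bound.\<close>

lemma Holder_integral:
  fixes f g :: "'a \<Rightarrow> real"
  assumes pq: "p > 1" "q > 1" "1 / p + 1 / q = 1"
    and [measurable]: "f \<in> borel_measurable M" "g \<in> borel_measurable M"
    and nn: "\<And>x. f x \<ge> 0" "\<And>x. g x \<ge> 0"
    and intf: "integrable M (\<lambda>x. f x powr q)" and intg: "integrable M (\<lambda>x. g x powr p)"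
  shows "integrable M (\<lambda>x. f x * g x)"
    and "(\<integral>x. f x * g x \<partial>M) \<le> (\<integral>x. f x powr q \<partial>M) powr (1/q) * (\<integral>x. g x powr p \<partial>M) powr (1/p)"
proof -
  have young: "a * b \<le> a powr q / q + b powr p / p" if "a \<ge> 0" "b \<ge> 0" for a b :: real
    using Youngs_inequality[of q p a b] that pq by (simp add: add.commute)
  show int: "integrable M (\<lambda>x. f x * g x)"
    by (rule Bochner_Integration.integrable_bound[where f = "\<lambda>x. f x powr q / q + g x powr p / p"])
       (use intf intg young nn pq in \<open>auto simp: abs_mult intro!: AE_I2\<close>)
  define X Y where "X = (\<integral>x. f x powr q \<partial>M)" and "Y = (\<integral>x. g x powr p \<partial>M)"
  have XY: "X \<ge> 0" "Y \<ge> 0" by (auto simp: X_def Y_def)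
  show "(\<integral>x. f x * g x \<partial>M) \<le> (\<integral>x. f x powr q \<partial>M) powr (1/q) * (\<integral>x. g x powr p \<partial>M) powr (1/p)"
  \<comment> \<open>Division by the norms is impossible if one of them vanishes. In that case the
    product is 0 almost everywhere.\<close>
  proof (cases "X = 0 \<or> Y = 0")
    case True
    then have "AE x in M. f x * g x = 0"
    proof
      assume "X = 0"
      then have "AE x in M. f x powr q = 0"
        using intf by (subst (asm) X_def, subst (asm) integral_nonneg_eq_0_iff_AE) auto
      then show ?thesis by (auto)
    next
      assume "Y = 0"
      then have "AE x in M. g x powr p = 0"
        using intg by (subst (asm) Y_def, subst (asm) integral_nonneg_eq_0_iff_AE) auto
      then show ?thesis by (auto)
    qed
    then have "(\<integral>x. f x * g x \<partial>M) = 0" by (simp add: integral_eq_zero_AE)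
    then show ?thesis by simp
  next
    case False
    with XY have pos: "X > 0" "Y > 0" by auto
    define C where "C = X powr (1/q) * Y powr (1/p)"
    have C: "C > 0" using pos by (simp add: C_def)
    \<comment> \<open>Here \<open>C\<close> is the product of the two norms, and the bracket on the
      right integrates to \<open>1 / q + 1 / p = 1\<close>.\<close>
    have "f x * g x \<le> C * (f x powr q / X / q + g x powr p / Y / p)" for x
    proof -
      have "(f x / X powr (1/q)) * (g x / Y powr (1/p)) \<le>
        (f x / X powr (1/q)) powr q / q + (g x / Y powr (1/p)) powr p / p"
        using nn by (intro young) auto
      also have "(f x / X powr (1/q)) powr q = f x powr q / X"
        using nn pos pq by (simp add: powr_divide powr_powr)
      also have "(g x / Y powr (1/p)) powr p = g x powr p / Y"
        using nn pos pq by (simp add: powr_divide powr_powr)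
      finally show ?thesis
        using C by (simp add: C_def field_simps)
    qed
    then have "(\<integral>x. f x * g x \<partial>M) \<le> (\<integral>x. C * (f x powr q / X / q + g x powr p / Y / p) \<partial>M)"
      using int intf intg by (intro integral_mono) auto
    also have "\<dots> = C * (X / X / q + Y / Y / p)"
      using intf intg by (simp add: X_def Y_def)
    also have "\<dots> = C" using pos pq by (simp add: add.commute)
    finally show ?thesis by (simp add: C_def X_def Y_def)
  qed
qed

section \<open>Integrals of powers of the cosine\<close>

text \<open>The shifted window is \<open>{-s..T-s}\<close>. Its part left of 0 is moved by one
  period onto \<open>{T-s..T}\<close>, which completes \<open>{0..T-s}\<close> to a full
  period.\<close>

lemma integral_periodic_shift:
  fixes h :: "real \<Rightarrow> real"
  assumes cont: "continuous_on UNIV h" and per: "\<And>t. h (t + T) = h t"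
    and s: "0 \<le> s" "s \<le> T"
  shows "integral {0..T} (\<lambda>t. h (t - s)) = integral {0..T} h"
proof -
  have ints: "h integrable_on {a..b}" for a b
    by (intro integrable_continuous_interval continuous_on_subset[OF cont]) auto
  have shift: "integral {a..b} (\<lambda>t. h (t + c)) = integral {a+c..b+c} h" for a b c
    using integral_shift_Icc_real[of a b h c] by (simp add: o_def add.commute)
  have "integral {0..T} (\<lambda>t. h (t - s)) = integral {-s..T-s} h"
    using shift[of 0 T "-s"] by simp
  also have "\<dots> = integral {-s..0} h + integral {0..T-s} h"
    using s by (intro Henstock_Kurzweil_Integration.integral_combine[symmetric] ints) auto
  also have "integral {-s..0} h = integral {T-s..T} h"
    using shift[of "-s" 0 T] per by simp
  also have "integral {T-s..T} h + integral {0..T-s} h = integral {0..T} h"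
    using Henstock_Kurzweil_Integration.integral_combine[of 0 "T-s" T h] s ints by simp
  finally show ?thesis .
qed

text \<open>Substitute \<open>(sin t)\<^sup>2\<close> for the variable of the Beta integral; this
  map is increasing on the quarter period. The computation runs in the nonnegative Lebesgue
  integral, since the Beta integrand is unbounded at 0, and also at 1 when
  \<open>q < 1\<close>.\<close>

lemma integral_cos_powr_quarter:
  assumes q: "(q::real) > 0"
  shows "integral {0..pi/2} (\<lambda>t. \<bar>cos t\<bar> powr q) = Beta (1/2) ((q+1)/2) / 2"
proof -
  define f :: "real \<Rightarrow> real" where "f t = t powr (1/2 - 1) * (1 - t) powr ((q+1)/2 - 1)" for t
  have [measurable]: "f \<in> borel_measurable borel"
    unfolding f_def by measurable
  have cont: "continuous_on {0..pi/2} (\<lambda>t. \<bar>cos t\<bar> powr q)"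
    using q by (intro continuous_intros continuous_on_powr') auto
  have "ennreal (Beta (1/2) ((q+1)/2)) = (\<integral>\<^sup>+t. f t * indicator {0..1} t \<partial>lborel)"
  proof -
    have "(f has_integral Beta (1/2) ((q+1)/2)) {0..1}"
      unfolding f_def using q by (intro has_integral_Beta_real) auto
    moreover have "f t \<ge> 0" for t
      by (simp add: f_def)
    ultimately show ?thesis
      using nn_integral_has_integral_lebesgue[of "{0..1}" f] by (simp add: mult.commute)
  qed
  also have "\<dots> = (\<integral>\<^sup>+t. f t * indicator {(sin 0)\<^sup>2..(sin (pi/2))\<^sup>2} t \<partial>lborel)"
    by simp
  also have "\<dots> = (\<integral>\<^sup>+t. f ((sin t)\<^sup>2) * (2 * sin t * cos t) * indicator {0..pi/2} t \<partial>lborel)"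
    by (rule nn_integral_substitution)
      (auto intro!: derivative_eq_intros continuous_intros mult_nonneg_nonneg sin_ge_zero cos_ge_zero
        simp: set_borel_measurable_def)
  also have "\<dots> = (\<integral>\<^sup>+t. 2 * \<bar>cos t\<bar> powr q * indicator {0..pi/2} t \<partial>lborel)"
  proof (intro nn_integral_cong_AE)
    \<comment> \<open>At \<open>t = 0\<close> the two integrands really differ: the left one
      vanishes because \<open>0 powr x = 0\<close>, the right one is 2. At \<open>pi/2\<close> the
      cancellation below would divide by \<open>cos t = 0\<close>. Both points form a null
      set.\<close>
    have "AE t in lborel. t \<noteq> 0 \<and> t \<noteq> pi/2"
      using AE_lborel_singleton[of 0] AE_lborel_singleton[of "pi/2"] by auto
    then show "AE t in lborel. ennreal (f ((sin t)\<^sup>2) * (2 * sin t * cos t) * indicator {0..pi/2} t) =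
        ennreal (2 * \<bar>cos t\<bar> powr q * indicator {0..pi/2} t)"
    proof eventually_elim
      case (elim t)
      show ?case
      proof (cases "t \<in> {0..pi/2}")
        case True
        with elim have t: "0 < t" "t < pi/2" by auto
        have s: "sin t > 0" using t by (intro sin_gt_zero) auto
        have c: "cos t > 0" using t by (intro cos_gt_zero) auto
        have "((sin t)\<^sup>2) powr (1/2 - 1) = 1 / sin t"
          using s by (simp add: powr_powr powr_minus_divide flip: powr_numeral)
        moreover have "((cos t)\<^sup>2) powr ((q+1)/2 - 1) = cos t powr q / cos t"
        proof -
          have "((cos t)\<^sup>2) powr ((q+1)/2 - 1) = cos t powr (q - 1)"
            using c by (simp add: powr_powr diff_divide_distrib flip: powr_numeral)
          then show ?thesis using c by (simp add: powr_diff)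
        qed
        moreover have "f ((sin t)\<^sup>2) = ((sin t)\<^sup>2) powr (1/2 - 1) * ((cos t)\<^sup>2) powr ((q+1)/2 - 1)"
          unfolding f_def cos_squared_eq ..
        ultimately have "f ((sin t)\<^sup>2) * (2 * sin t * cos t) = 2 * cos t powr q"
          using s c by simp
        then show ?thesis using c by (simp only: abs_of_pos)
      qed simp
    qed
  qed
  also have "\<dots> = ennreal (integral {0..pi/2} (\<lambda>t. 2 * \<bar>cos t\<bar> powr q))"
  proof -
    have "((\<lambda>t. 2 * \<bar>cos t\<bar> powr q) has_integral integral {0..pi/2} (\<lambda>t. 2 * \<bar>cos t\<bar> powr q)) {0..pi/2}"
      by (intro integrable_integral integrable_continuous_interval continuous_intros cont)
    from nn_integral_has_integral_lebesgue[OF _ this] show ?thesis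
      by (simp add: mult_ac)
  qed
  finally have "ennreal (Beta (1/2) ((q+1)/2)) = ennreal (integral {0..pi/2} (\<lambda>t. 2 * \<bar>cos t\<bar> powr q))" .
  moreover have "Beta (1/2) ((q+1)/2) \<ge> 0"
  proof -
    have "Gamma (1/2 + (q+1)/2) > 0" "Gamma ((q+1)/2) > 0" "Gamma (1/2::real) > 0"
      using q by (auto intro!: Gamma_real_pos add_pos_pos)
    then show ?thesis by (simp add: Beta_def)
  qed
  moreover have "integral {0..pi/2} (\<lambda>t. 2 * \<bar>cos t\<bar> powr q) \<ge> 0"
    by (intro Henstock_Kurzweil_Integration.integral_nonneg integrable_continuous_interval
        continuous_intros cont) auto
  ultimately have "Beta (1/2) ((q+1)/2) = integral {0..pi/2} (\<lambda>t. 2 * \<bar>cos t\<bar> powr q)"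
    by simp
  then show ?thesis by simp
qed

text \<open>The reflection at 0 and the shift by \<open>pi\<close> preserve
  \<open>\<bar>cos t\<bar>\<close>, so the period consists of four equal quarters, each given by the
  Beta integral.\<close>

lemma integral_abs_cos_powr:
  assumes q: "(q::real) > 0"
  shows "integral {0..2*pi} (\<lambda>t. \<bar>cos t\<bar> powr q) =
    2 * pi * (Gamma ((1 + q) / 2) / (sqrt pi * Gamma ((2 + q) / 2)))"
proof -
  define h where "h t = \<bar>cos t\<bar> powr q" for t :: real
  have cont: "continuous_on S h" for S
    unfolding h_def using q by (intro continuous_intros continuous_on_powr') auto
  have ints: "h integrable_on {a..b}" for a b
    by (intro integrable_continuous_interval cont)
  have shift: "integral {a..b} (\<lambda>t. h (t + c)) = integral {a+c..b+c} h" for a b c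
    using integral_shift_Icc_real[of a b h c] by (simp add: o_def add.commute)
  have "integral {pi/2..pi} h = integral {-pi..-(pi/2)} (\<lambda>t. h (- t))"
    by (simp add: integral_reflect_real)
  also have "\<dots> = integral {-pi..-(pi/2)} (\<lambda>t. h (t + pi))"
    by (simp add: h_def)
  also have "\<dots> = integral {0..pi/2} h" using shift[of "-pi" "-(pi/2)" pi] by simp
  finally have "integral {0..pi} h = 2 * integral {0..pi/2} h"
    using Henstock_Kurzweil_Integration.integral_combine[of 0 "pi/2" pi h] ints by simp
  moreover have "integral {pi..2*pi} h = integral {0..pi} h"
    using shift[of 0 pi pi] by (simp add: h_def [abs_def])
  ultimately have "integral {0..2*pi} h = 4 * integral {0..pi/2} h"
    using Henstock_Kurzweil_Integration.integral_combine[of 0 "pi" "2*pi" h] ints by simp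
  also have "\<dots> = 2 * Beta (1/2) ((q+1)/2)"
    using integral_cos_powr_quarter[OF q] by (simp add: h_def [abs_def])
  also have "\<dots> = 2 * pi * (Gamma ((1 + q) / 2) / (sqrt pi * Gamma ((2 + q) / 2)))"
  proof -
    have "1/2 + (q+1)/2 = (2+q)/2" "(q+1)/2 = (1+q)/2" by (simp_all add: field_simps)
    then have "Beta (1/2) ((q+1)/2) = sqrt pi * Gamma ((1 + q) / 2) / Gamma ((2 + q) / 2)"
      unfolding Beta_def Gamma_one_half_real by (simp only:)
    \<comment> \<open>Writing \<open>sqrt pi\<close> as \<open>pi / sqrt pi\<close> brings out the
      length \<open>2 * pi\<close> of the period, and what remains is the mean.\<close>
    also have "\<dots> = pi / sqrt pi * Gamma ((1 + q) / 2) / Gamma ((2 + q) / 2)"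
      by (simp only: real_div_sqrt[OF pi_ge_zero])
    finally show ?thesis by simp
  qed
  finally show ?thesis by (simp add: h_def [abs_def])
qed

section \<open>The circle as a finite measure space\<close>

text \<open>Restricting the measure turns set integrals into plain integrals. The total mass is
  \<open>2 * pi\<close>, so normalized means carry an explicit factor
  \<open>1 / (2 * pi)\<close>.\<close>

abbreviation circle :: "real measure" where
  "circle \<equiv> restrict_space lborel {0..2*pi}"

lemma set_lebesgue_integral_circle:
  fixes f :: "real \<Rightarrow> 'a::{banach, second_countable_topology}"
  shows "(LINT t:{0..2*pi}|lborel. f t) = (\<integral>t. f t \<partial>circle)"
  by (simp add: set_lebesgue_integral_def integral_restrict_space)

lemma nn_integral_circle:
  "(\<integral>\<^sup>+t\<in>{0..2*pi}. f t \<partial>lborel) = (\<integral>\<^sup>+t. f t \<partial>circle)"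
  by (simp add: nn_integral_restrict_space)

lemma set_borel_measurable_circle:
  fixes f :: "real \<Rightarrow> 'a::real_normed_vector"
  shows "set_borel_measurable lborel {0..2*pi} f \<longleftrightarrow> f \<in> borel_measurable circle"
  by (simp add: set_borel_measurable_def borel_measurable_restrict_space_iff)

lemma emeasure_circle: "emeasure circle (space circle) = ennreal (2 * pi)"
  by (simp add: space_restrict_space emeasure_restrict_space)

lemma finite_measure_circle: "finite_measure circle"
  by (rule finite_measureI) (unfold emeasure_circle, simp)

lemma measurable_ident_circle [measurable]: "(\<lambda>t. t) \<in> borel_measurable circle"
  by (simp add: measurable_restrict_space1)

lemma integral_circle:
  fixes h :: "real \<Rightarrow> real"
  assumes "continuous_on {0..2*pi} h"
  shows "integrable circle h" and "(\<integral>t. h t \<partial>circle) = integral {0..2*pi} h"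
proof -
  have *: "set_integrable lborel {0..2*pi} h"
    unfolding set_integrable_def using borel_integrable_atLeastAtMost'[OF assms] by (simp add: set_integrable_def)
  then show "integrable circle h"
    by (simp add: integrable_restrict_space set_integrable_def)
  show "(\<integral>t. h t \<partial>circle) = integral {0..2*pi} h"
    using set_borel_integral_eq_integral(2)[OF *] by (simp add: set_lebesgue_integral_circle)
qed

section \<open>Differentiation under the integral at the origin\<close>

text \<open>As \<open>z * cis (- t)\<close> has the same modulus as \<open>z\<close>, a single
  radius \<open>d\<close> from the differentiability of \<open>K\<close> at 0 works for all
  \<open>t\<close>. The remainder of the integral is then at most a small multiple of
  \<open>norm y\<close> times the integral of \<open>norm (g t)\<close>, and no limit theorem for
  integrals is involved.\<close>

lemma has_derivative_integral_rotation:
  fixes K K' :: "complex \<Rightarrow> real" and g :: "real \<Rightarrow> complex"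
  assumes K: "(K has_derivative K') (at 0)"
    and [measurable]: "K \<in> borel_measurable borel" and g: "integrable circle g"
  shows "((\<lambda>z. \<integral>t. of_real (K (z * cis (- t))) * g t \<partial>circle) has_derivative
     (\<lambda>h. \<integral>t. of_real (K' (h * cis (- t))) * g t \<partial>circle)) (at 0)"
proof -
  have bl: "bounded_linear K'" using K by (rule has_derivative_bounded_linear)
  then interpret K': bounded_linear K' .
  have [measurable]: "K' \<in> borel_measurable borel"
    by (intro borel_measurable_continuous_onI linear_continuous_on bl)
  have [measurable]: "g \<in> borel_measurable circle" using g by auto
  have [measurable]: "cis \<in> borel_measurable borel"
    by (intro borel_measurable_continuous_onI continuous_intros)
  obtain B where B: "B \<ge> 0" "\<And>h. \<bar>K' h\<bar> \<le> norm h * B"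
    using K'.nonneg_bounded by auto
  have intK': "integrable circle (\<lambda>t. of_real (K' (h * cis (- t))) * g t)" for h
  proof (rule Bochner_Integration.integrable_bound[where f = "\<lambda>t. (norm h * B) *\<^sub>R g t"])
    show "AE t in circle. norm (of_real (K' (h * cis (- t))) * g t) \<le> norm ((norm h * B) *\<^sub>R g t)"
      using B(2)[of "h * cis (- t)" for t] B(1)
      by (intro AE_I2) (auto simp: norm_mult abs_mult intro!: mult_right_mono)
  qed (use g in auto)
  define I where "I = (\<integral>t. norm (g t) \<partial>circle)"
  have I: "I \<ge> 0" by (simp add: I_def)
  have "bounded_linear (\<lambda>h. \<integral>t. of_real (K' (h * cis (- t))) * g t \<partial>circle)"
  proof (rule bounded_linear_intro[where K = "B * I"])
    fix x y
    show "(\<integral>t. of_real (K' ((x + y) * cis (- t))) * g t \<partial>circle) =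
      (\<integral>t. of_real (K' (x * cis (- t))) * g t \<partial>circle) + (\<integral>t. of_real (K' (y * cis (- t))) * g t \<partial>circle)"
      unfolding Bochner_Integration.integral_add[OF intK' intK', symmetric]
      by (simp add: K'.add distrib_right)
  next
    fix r :: real and x
    show "(\<integral>t. of_real (K' ((r *\<^sub>R x) * cis (- t))) * g t \<partial>circle) =
      r *\<^sub>R (\<integral>t. of_real (K' (x * cis (- t))) * g t \<partial>circle)"
      unfolding mult_scaleR_left K'.scaleR integral_scaleR_right[symmetric]
      by (simp add: scaleR_conv_of_real mult.assoc)
  next
    fix x
    have "norm (\<integral>t. of_real (K' (x * cis (- t))) * g t \<partial>circle) \<le> (\<integral>t. norm x * B * norm (g t) \<partial>circle)"
      using B(2)[of "x * cis (- t)" for t] g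
      by (intro order.trans[OF integral_norm_bound] integral_mono integrable_norm intK')
         (auto simp: norm_mult intro!: mult_right_mono)
    then show "norm (\<integral>t. of_real (K' (x * cis (- t))) * g t \<partial>circle) \<le> norm x * (B * I)"
      by (simp add: I_def mult_ac)
  qed
  moreover have "\<exists>d>0. \<forall>y. norm (y - 0) < d \<longrightarrow>
      norm ((\<integral>t. of_real (K (y * cis (- t))) * g t \<partial>circle) - (\<integral>t. of_real (K (0 * cis (- t))) * g t \<partial>circle) -
        (\<integral>t. of_real (K' ((y - 0) * cis (- t))) * g t \<partial>circle)) \<le> e * norm (y - 0)" if "e > 0" for e
  proof -
    \<comment> \<open>The summand 1 keeps the quotient meaningful for \<open>I = 0\<close>, and
      \<open>e' * I \<le> e\<close> holds in every case.\<close>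
    define e' where "e' = e / (I + 1)"
    have "e' > 0" using that I by (simp add: e'_def)
    then obtain d where d: "d > 0" "\<And>y. norm y < d \<Longrightarrow> \<bar>K y - K 0 - K' y\<bar> \<le> e' * norm y"
      using K unfolding has_derivative_at_alt by force
    show ?thesis
    proof (intro exI[of _ d] conjI allI impI)
      fix y :: complex assume "norm (y - 0) < d"
      then have est: "\<bar>K (y * cis (- t)) - K 0 - K' (y * cis (- t))\<bar> \<le> e' * norm y" for t
        using d(2)[of "y * cis (- t)"] by (simp add: norm_mult)
      have intR: "integrable circle (\<lambda>t. of_real (K (y * cis (- t)) - K 0 - K' (y * cis (- t))) * g t)"
      proof (rule Bochner_Integration.integrable_bound[where f = "\<lambda>t. (e' * norm y) *\<^sub>R g t"])
        show "AE t in circle. norm (of_real (K (y * cis (- t)) - K 0 - K' (y * cis (- t))) * g t) \<le> norm ((e' * norm y) *\<^sub>R g t)"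
          using est \<open>e' > 0\<close> unfolding norm_mult norm_of_real
          by (intro AE_I2) (auto simp: abs_mult intro!: mult_right_mono)
      qed (use g in auto)
      have int0: "integrable circle (\<lambda>t. of_real (K 0) * g t)"
        using g by auto
      have "(\<integral>t. of_real (K (y * cis (- t))) * g t \<partial>circle) =
        (\<integral>t. of_real (K (y * cis (- t)) - K 0 - K' (y * cis (- t))) * g t + of_real (K 0) * g t +
            of_real (K' (y * cis (- t))) * g t \<partial>circle)"
        by (simp add: algebra_simps)
      also have "\<dots> = (\<integral>t. of_real (K (y * cis (- t)) - K 0 - K' (y * cis (- t))) * g t \<partial>circle) +
         (\<integral>t. of_real (K 0) * g t \<partial>circle) + (\<integral>t. of_real (K' (y * cis (- t))) * g t \<partial>circle)"
        by (simp only: Bochner_Integration.integral_add Bochner_Integration.integrable_add intR int0 intK')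
      finally have "norm ((\<integral>t. of_real (K (y * cis (- t))) * g t \<partial>circle) - (\<integral>t. of_real (K (0 * cis (- t))) * g t \<partial>circle) -
        (\<integral>t. of_real (K' ((y - 0) * cis (- t))) * g t \<partial>circle)) =
        norm (\<integral>t. of_real (K (y * cis (- t)) - K 0 - K' (y * cis (- t))) * g t \<partial>circle)"
        by simp
      also have "\<dots> \<le> (\<integral>t. e' * norm y * norm (g t) \<partial>circle)"
        using est g unfolding norm_mult norm_of_real
        by (intro order.trans[OF integral_norm_bound] integral_mono integrable_norm intR)
           (auto simp: norm_mult simp del: of_real_diff intro!: mult_right_mono)
      also have "\<dots> = e' * I * norm y" by (simp add: I_def)
      also have "\<dots> \<le> e * norm y"
        using I that by (intro mult_right_mono) (auto simp: e'_def field_simps)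
      finally show "norm ((\<integral>t. of_real (K (y * cis (- t))) * g t \<partial>circle) - (\<integral>t. of_real (K (0 * cis (- t))) * g t \<partial>circle) -
        (\<integral>t. of_real (K' ((y - 0) * cis (- t))) * g t \<partial>circle)) \<le> e * norm (y - 0)" by simp
    qed (fact d)
  qed
  ultimately show ?thesis unfolding has_derivative_at_alt by blast
qed

lemma P_alpha_has_derivative_0:
  assumes "integrable circle g"
  shows "(P_alpha \<alpha> g has_derivative (\<lambda>h. of_real (c_alpha \<alpha> * (\<alpha> + 2) / (2 * pi)) *
    (\<integral>t. of_real (Re (h * cis (- t))) * g t \<partial>circle))) (at 0)"
proof -
  have "((\<lambda>z. of_real (1 / (2 * pi)) * (\<integral>t. of_real (K_alpha \<alpha> (z * cis (- t))) * g t \<partial>circle)) has_derivative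
    (\<lambda>h. of_real (1 / (2 * pi)) * (\<integral>t. of_real (c_alpha \<alpha> * (\<alpha> + 2) * Re (h * cis (- t))) * g t \<partial>circle))) (at 0)"
    by (intro has_derivative_mult_right has_derivative_integral_rotation K_alpha_has_derivative_0 assms) auto
  moreover have "(\<integral>t. of_real (c_alpha \<alpha> * (\<alpha> + 2) * Re (h * cis (- t))) * g t \<partial>circle) =
      of_real (c_alpha \<alpha> * (\<alpha> + 2)) * (\<integral>t. of_real (Re (h * cis (- t))) * g t \<partial>circle)" for h
    by (subst integral_mult_right_zero[symmetric]) (simp only: of_real_mult mult.assoc)
  moreover have "P_alpha \<alpha> g = (\<lambda>z. of_real (1 / (2 * pi)) * (\<integral>t. of_real (K_alpha \<alpha> (z * cis (- t))) * g t \<partial>circle))"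
    by (rule ext) (simp only: P_alpha_def set_lebesgue_integral_circle)
  ultimately show ?thesis
    by (simp add: mult_ac)
qed

section \<open>The constants\<close>

text \<open>By \<open>integral_abs_cos_powr\<close> this is the mean of
  \<open>\<bar>cos t\<bar> powr q\<close> over a full period when \<open>q > 0\<close>.\<close>

definition cos_mean :: "real \<Rightarrow> real" where
  "cos_mean q = Gamma ((1 + q) / 2) / (sqrt pi * Gamma ((2 + q) / 2))"

lemma sharp_const_altdef:
  "sharp_const \<alpha> q = c_alpha \<alpha> * (\<alpha> + 2) * cos_mean q powr (1 / q)"
  by (simp add: sharp_const_def c_alpha_def cos_mean_def)

lemma cos_mean_pos: "q > 0 \<Longrightarrow> cos_mean q > 0"
  by (auto simp: cos_mean_def intro!: divide_pos_pos mult_pos_pos Gamma_real_pos)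

lemma c_alpha_pos: "\<alpha> > -1 \<Longrightarrow> c_alpha \<alpha> > 0"
  by (auto simp: c_alpha_def intro!: divide_pos_pos Gamma_real_pos zero_less_power)

lemma integral_circle_cos_powr:
  assumes q: "q > 0" and s: "0 \<le> s" "s \<le> 2 * pi"
  shows "integrable circle (\<lambda>t. \<bar>cos (t - s)\<bar> powr q)"
    and "(\<integral>t. \<bar>cos (t - s)\<bar> powr q \<partial>circle) = 2 * pi * cos_mean q"
proof -
  have cont: "continuous_on S (\<lambda>t. \<bar>cos (t - s)\<bar> powr q)" for S s
    using q by (intro continuous_intros continuous_on_powr') auto
  show "integrable circle (\<lambda>t. \<bar>cos (t - s)\<bar> powr q)"
    by (intro integral_circle cont)
  show "(\<integral>t. \<bar>cos (t - s)\<bar> powr q \<partial>circle) = 2 * pi * cos_mean q"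
    using integral_periodic_shift[of "\<lambda>t. \<bar>cos t\<bar> powr q" "2 * pi" s] cont[of _ 0] s q
    by (simp add: integral_circle(2)[OF cont] integral_abs_cos_powr cos_mean_def)
qed

section \<open>Lebesgue spaces and the pairing with the cosine\<close>

lemma in_Lp_infinity:
  assumes "in_Lp \<infinity> g"
  shows "g \<in> borel_measurable circle" "AE t in circle. cmod (g t) \<le> Lp_norm \<infinity> g"
proof -
  let ?E = "esssup circle (\<lambda>t. ereal (cmod (g t)))"
  show "g \<in> borel_measurable circle" using assms by (simp add: in_Lp_def set_borel_measurable_circle)
  have fin: "?E < \<infinity>" and N: "Lp_norm \<infinity> g = real_of_ereal ?E"
    using assms by (auto simp: in_Lp_def Lp_norm_def)
  have AE: "AE t in circle. ereal (cmod (g t)) \<le> ?E" by (rule esssup_AE)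
  show "AE t in circle. cmod (g t) \<le> Lp_norm \<infinity> g"
    using AE
  proof eventually_elim
    case (elim t)
    \<comment> \<open>\<open>real_of_ereal\<close> is faithful only at finite values:
      \<open>fin\<close> excludes \<infinity>, and an upper bound of a norm is never
      -\<infinity>.\<close>
    then show ?case using fin unfolding N by (cases ?E) auto
  qed
qed

lemma in_Lp_real:
  assumes "r > 0"
  shows "in_Lp (ereal r) g \<longleftrightarrow> g \<in> borel_measurable circle \<and> integrable circle (\<lambda>t. cmod (g t) powr r)"
proof (cases "g \<in> borel_measurable circle")
  case [measurable]: True
  show ?thesis
    using True by (simp add: in_Lp_def set_borel_measurable_circle nn_integral_circle integrable_iff_bounded)
qed (simp add: in_Lp_def set_borel_measurable_circle)

lemma Lp_norm_real:
  assumes "in_Lp (ereal r) g" "r > 0"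
  shows "Lp_norm (ereal r) g = ((\<integral>t. cmod (g t) powr r \<partial>circle) / (2 * pi)) powr (1 / r)"
proof -
  have "integrable circle (\<lambda>t. cmod (g t) powr r)" using assms by (simp add: in_Lp_real)
  then have "(\<integral>\<^sup>+t. ennreal (cmod (g t) powr r) \<partial>circle) = ennreal (\<integral>t. cmod (g t) powr r \<partial>circle)"
    by (intro nn_integral_eq_integral) auto
  then show ?thesis by (simp add: Lp_norm_def nn_integral_circle)
qed

text \<open>The measure is finite, so for finite \<open>p\<close> Hoelder's inequality against the
  constant 1 applies, while for \<open>p = \<infinity>\<close> an almost everywhere bound is
  enough.\<close>

lemma in_Lp_integrable:
  assumes "in_Lp p g" "1 < p"
  shows "integrable circle g"
proof (cases p)
  case (real r)
  then have r: "r > 1" using assms by simp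
  interpret finite_measure circle by (rule finite_measure_circle)
  from assms r real have [measurable]: "g \<in> borel_measurable circle"
    and i: "integrable circle (\<lambda>t. cmod (g t) powr r)" by (auto simp: in_Lp_real)
  have "r / (r - 1) > 1" "1 / r + 1 / (r / (r - 1)) = 1"
    using r by (auto simp: field_simps)
  then have "integrable circle (\<lambda>t. 1 * cmod (g t))"
    using r i by (intro Holder_integral(1)[where p = r and q = "r / (r - 1)"]) auto
  then show ?thesis by (simp add: integrable_norm_iff)
next
  case PInf
  interpret finite_measure circle by (rule finite_measure_circle)
  show ?thesis
    using in_Lp_infinity[of g] assms PInf by (intro integrable_const_bound) auto
qed (use assms in auto)

text \<open>The bound does not depend on \<open>s\<close>, because the mean of
  \<open>\<bar>cos (t - s)\<bar> powr q\<close> does not.\<close>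

lemma Holder_cos:
  assumes g: "in_Lp p g" and p: "1 < p" and s: "0 \<le> s" "s \<le> 2 * pi"
  shows "integrable circle (\<lambda>t. \<bar>cos (t - s)\<bar> * cmod (g t))"
    and "(\<integral>t. \<bar>cos (t - s)\<bar> * cmod (g t) \<partial>circle) \<le>
      2 * pi * (cos_mean (conj_exp p) powr (1 / conj_exp p) * Lp_norm p g)"
proof -
  have gi: "integrable circle g" by (rule in_Lp_integrable) fact+
  then have [measurable]: "g \<in> borel_measurable circle" by auto
  show int: "integrable circle (\<lambda>t. \<bar>cos (t - s)\<bar> * cmod (g t))"
    by (rule Bochner_Integration.integrable_bound[OF gi]) (auto simp: abs_mult intro!: mult_left_le_one_le)
  show "(\<integral>t. \<bar>cos (t - s)\<bar> * cmod (g t) \<partial>circle) \<le>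
      2 * pi * (cos_mean (conj_exp p) powr (1 / conj_exp p) * Lp_norm p g)"
  proof (cases p)
    case (real r)
    then have r: "r > 1" using p by simp
    define q where "q = r / (r - 1)"
    have q: "q > 1" "1 / r + 1 / q = 1" "conj_exp p = q"
      using r real by (auto simp: q_def field_simps conj_exp_def)
    have i: "integrable circle (\<lambda>t. cmod (g t) powr r)" using g r real by (auto simp: in_Lp_real)
    define Y where "Y = (\<integral>t. cmod (g t) powr r \<partial>circle) / (2 * pi)"
    have Y: "Y \<ge> 0" by (simp add: Y_def)
    have "(\<integral>t. \<bar>cos (t - s)\<bar> * cmod (g t) \<partial>circle) \<le>
      (\<integral>t. \<bar>cos (t - s)\<bar> powr q \<partial>circle) powr (1/q) * (\<integral>t. cmod (g t) powr r \<partial>circle) powr (1/r)"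
      using r q s i by (intro Holder_integral) (auto intro!: integral_circle_cos_powr(1))
    also have "\<dots> = (2 * pi * cos_mean q) powr (1/q) * (2 * pi * Y) powr (1/r)"
      using q s by (simp add: integral_circle_cos_powr(2) Y_def)
    \<comment> \<open>Since the exponents \<open>1/q\<close> and \<open>1/r\<close> add up to 1, the
      powers of \<open>2 * pi\<close> merge into one factor, and the normalized norm
      appears.\<close>
    also have "\<dots> = ((2 * pi) powr (1/q) * (2 * pi) powr (1/r)) * (cos_mean q powr (1/q) * Y powr (1/r))"
      using Y cos_mean_pos[of q] q by (simp add: powr_mult)
    also have "(2 * pi) powr (1/q) * (2 * pi) powr (1/r) = (2 * pi :: real)"
      using q by (simp add: add.commute flip: powr_add)
    finally show ?thesis using q g r real by (simp add: Lp_norm_real Y_def)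
  next
    case PInf
    \<comment> \<open>The exponent 1 is written out so that the integral is the case
      \<open>q = 1\<close> of \<open>integral_circle_cos_powr\<close>.\<close>
    have "(\<integral>t. \<bar>cos (t - s)\<bar> * cmod (g t) \<partial>circle) \<le> (\<integral>t. \<bar>cos (t - s)\<bar> powr 1 * Lp_norm \<infinity> g \<partial>circle)"
      using int integral_circle_cos_powr(1)[of 1 s] s in_Lp_infinity(2)[of g] g PInf
      by (intro integral_mono_AE) (auto elim!: eventually_mono intro!: mult_left_mono)
    also have "\<dots> = 2 * pi * (cos_mean 1 * Lp_norm \<infinity> g)"
      using integral_circle_cos_powr(2)[of 1 s] s by (simp del: powr_one)
    finally show ?thesis using PInf cos_mean_pos[of 1] by (simp add: conj_exp_def)
  qed (use p in auto)
qed

section \<open>The extremal boundary function\<close>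

text \<open>For \<open>q = 1\<close>, that is \<open>p = \<infinity>\<close>, this is the sign of
  the cosine.\<close>

definition extremal :: "real \<Rightarrow> real \<Rightarrow> complex" where
  "extremal q t = of_real (sgn (cos t) * \<bar>cos t\<bar> powr (q - 1))"

lemma norm_extremal: "cmod (extremal q t) = (if cos t = 0 then 0 else \<bar>cos t\<bar> powr (q - 1))"
  by (simp add: extremal_def norm_mult abs_mult abs_sgn_eq)

lemma borel_measurable_extremal [measurable]: "extremal q \<in> borel_measurable borel"
  unfolding extremal_def [abs_def] sgn_real_def by measurable

lemma cos_times_extremal: "of_real (cos t) * extremal q t = of_real (\<bar>cos t\<bar> powr q)"
proof (cases "cos t = 0")
  case False
  have "cos t * (sgn (cos t) * \<bar>cos t\<bar> powr (q - 1)) = \<bar>cos t\<bar> * \<bar>cos t\<bar> powr (q - 1)"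
    by (simp add: abs_sgn mult_ac)
  also have "\<dots> = \<bar>cos t\<bar> powr q"
    using False by (simp add: powr_diff)
  finally show ?thesis
    unfolding extremal_def of_real_mult[symmetric] by simp
qed (simp add: extremal_def)

text \<open>For finite \<open>p = r\<close> the relation \<open>(q - 1) * r = q\<close> makes the
  \<open>r\<close>-th power of the modulus equal to \<open>\<bar>cos t\<bar> powr q\<close>, so the
  norm is \<open>cos_mean q powr (1 / r)\<close>, and the exponents add up to 1. An upper bound on
  the norm suffices for sharpness, so for \<open>p = \<infinity>\<close> the essential supremum is
  only estimated by 1.\<close>

lemma Lp_norm_extremal:
  assumes p: "1 < p"
  defines "q \<equiv> conj_exp p"
  shows "in_Lp p (extremal q)" "cos_mean q powr (1 / q) * Lp_norm p (extremal q) \<le> cos_mean q"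
proof -
  have *: "in_Lp p (extremal q) \<and> cos_mean q powr (1 / q) * Lp_norm p (extremal q) \<le> cos_mean q"
  proof (cases p)
    case (real r)
    then have r: "r > 1" using p by simp
    have q: "q > 1" "1 / q + 1 / r = 1" "(q - 1) * r = q"
      using r real by (auto simp: q_def field_simps conj_exp_def)
    have norm_powr: "cmod (extremal q t) powr r = \<bar>cos (t - 0)\<bar> powr q" for t
      using q by (simp add: norm_extremal powr_powr)
    have Lp: "in_Lp (ereal r) (extremal q)"
      unfolding in_Lp_real[OF order.strict_trans[OF zero_less_one r]] norm_powr
      using q integral_circle_cos_powr(1)[of q 0] by simp
    have "Lp_norm (ereal r) (extremal q) = cos_mean q powr (1 / r)"
      using integral_circle_cos_powr(2)[of q 0] q r
      unfolding Lp_norm_real[OF Lp order.strict_trans[OF zero_less_one r]] norm_powr by simp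
    then have "cos_mean q powr (1 / q) * Lp_norm (ereal r) (extremal q) = cos_mean q"
      using q cos_mean_pos[of q] by (simp flip: powr_add)
    then show ?thesis using Lp real by simp
  next
    case PInf
    then have q: "q = 1" by (simp add: q_def conj_exp_def)
    let ?E = "esssup circle (\<lambda>t. ereal (cmod (extremal 1 t)))"
    have "?E \<le> 1"
      by (rule esssup_I) (auto simp: norm_extremal)
    \<comment> \<open>The value -\<infinity> is not ruled out here; \<open>real_of_ereal\<close>
      sends it to 0, which also obeys the bound.\<close>
    then have "?E < \<infinity>" "real_of_ereal ?E \<le> 1"
      by (cases ?E; auto)+
    then show ?thesis
      using q PInf cos_mean_pos[of 1]
      by (auto simp: in_Lp_def Lp_norm_def set_borel_measurable_circle)
  qed (use p in auto)
  then show "in_Lp p (extremal q)" "cos_mean q powr (1 / q) * Lp_norm p (extremal q) \<le> cos_mean q"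
    by auto
qed

section \<open>The upper bound and its sharpness\<close>

lemma Dnorm0_eq_onorm:
  "(f has_derivative f') (at 0) \<Longrightarrow> Dnorm0 f = onorm f'"
  unfolding Dnorm0_def by (simp flip: frechet_derivative_at)

text \<open>In polar form \<open>h\<close> has modulus \<open>cmod h\<close> and angle
  \<open>s\<close>, and the kernel becomes \<open>cmod h * cos (t - s)\<close>. Hence
  \<open>Holder_cos\<close> estimates the derivative equally in all directions.\<close>

lemma Dnorm0_P_alpha_le:
  assumes \<alpha>: "\<alpha> > -1" and p: "1 < p" and g: "in_Lp p g"
  shows "Dnorm0 (P_alpha \<alpha> g) \<le> sharp_const \<alpha> (conj_exp p) * Lp_norm p g"
proof -
  note gi = in_Lp_integrable[OF g p]
  define B where "B = cos_mean (conj_exp p) powr (1 / conj_exp p) * Lp_norm p g"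
  define c where "c = c_alpha \<alpha> * (\<alpha> + 2)"
  have c: "c > 0" using c_alpha_pos[OF \<alpha>] \<alpha> by (simp add: c_def)
  have bound: "cmod (\<integral>t. of_real (Re (h * cis (- t))) * g t \<partial>circle) \<le> cmod h * (2 * pi * B)" for h
  proof -
    define s where "s = Arg2pi h"
    have s: "0 \<le> s" "s \<le> 2 * pi"
      using Arg2pi_ge_0[of h] Arg2pi_lt_2pi[of h] by (auto simp: s_def)
    have "h = of_real (cmod h) * cis s"
      using Arg2pi_eq[of h] by (simp add: s_def cis_conv_exp)
    then have "h * cis (- t) = of_real (cmod h) * cis (s - t)" for t
      by (metis add_uminus_conv_diff cis_mult mult.assoc)
    then have Re: "Re (h * cis (- t)) = cmod h * cos (t - s)" for t
      by (simp add: cos_diff mult_ac)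
    have "cmod (\<integral>t. of_real (Re (h * cis (- t))) * g t \<partial>circle) \<le>
        (\<integral>t. cmod (of_real (Re (h * cis (- t))) * g t) \<partial>circle)"
      by (rule integral_norm_bound)
    also have "\<dots> = (\<integral>t. cmod h * (\<bar>cos (t - s)\<bar> * cmod (g t)) \<partial>circle)"
      unfolding Re by (simp add: norm_mult abs_mult mult.assoc)
    also have "\<dots> = cmod h * (\<integral>t. \<bar>cos (t - s)\<bar> * cmod (g t) \<partial>circle)"
      by (rule integral_mult_right_zero)
    also have "\<dots> \<le> cmod h * (2 * pi * B)"
      unfolding B_def using Holder_cos(2)[OF g p s] by (intro mult_left_mono) auto
    finally show ?thesis .
  qed
  \<comment> \<open>The bound at \<open>h = 1\<close> puts a norm below a positive multiple of
    \<open>B\<close>.\<close>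
  have "B \<ge> 0"
    using order.trans[OF norm_ge_zero bound[of 1]] pi_gt_zero
    by (auto simp: zero_le_mult_iff)
  have "onorm (\<lambda>h. of_real (c / (2 * pi)) * (\<integral>t. of_real (Re (h * cis (- t))) * g t \<partial>circle)) \<le> c * B"
  proof (rule onorm_bound)
    fix h
    have "norm (of_real (c / (2 * pi)) * (\<integral>t. of_real (Re (h * cis (- t))) * g t \<partial>circle)) \<le>
        c / (2 * pi) * (cmod h * (2 * pi * B))"
      unfolding norm_mult norm_of_real using c bound[of h] by (intro mult_mono) auto
    also have "\<dots> = c * B * cmod h" by simp
    finally show "norm (of_real (c / (2 * pi)) * (\<integral>t. of_real (Re (h * cis (- t))) * g t \<partial>circle)) \<le>
        c * B * cmod h" .
  qed (use c \<open>B \<ge> 0\<close> in auto)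
  then show ?thesis
    unfolding Dnorm0_eq_onorm[OF P_alpha_has_derivative_0[OF gi]]
    by (simp add: c_def B_def sharp_const_altdef mult.assoc)
qed

text \<open>The operator norm is at least the norm of the derivative at \<open>h = 1\<close>, where
  the integrand collapses to \<open>\<bar>cos t\<bar> powr q\<close>.\<close>

lemma Dnorm0_P_alpha_extremal_ge:
  assumes p: "1 < p" and \<alpha>: "\<alpha> > -1"
  defines "q \<equiv> conj_exp p"
  shows "c_alpha \<alpha> * (\<alpha> + 2) * cos_mean q \<le> Dnorm0 (P_alpha \<alpha> (extremal q))"
proof -
  have q: "q > 0"
    using p by (cases p) (auto simp: q_def conj_exp_def)
  define c where "c = c_alpha \<alpha> * (\<alpha> + 2)"
  have c: "c > 0" using c_alpha_pos[OF \<alpha>] \<alpha> by (simp add: c_def)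
  define L where "L h = of_real (c / (2 * pi)) * (\<integral>t. of_real (Re (h * cis (- t))) * extremal q t \<partial>circle)" for h
  have L: "(P_alpha \<alpha> (extremal q) has_derivative L) (at 0)"
    unfolding L_def c_def q_def
    by (intro P_alpha_has_derivative_0 in_Lp_integrable[OF Lp_norm_extremal(1)] p)
  have "(\<integral>t. of_real (Re (1 * cis (- t))) * extremal q t \<partial>circle) = (\<integral>t. complex_of_real (\<bar>cos (t - 0)\<bar> powr q) \<partial>circle)"
    by (simp add: cos_times_extremal)
  also have "\<dots> = of_real (\<integral>t. \<bar>cos (t - 0)\<bar> powr q \<partial>circle)"
    by (rule integral_of_real, rule integral_circle_cos_powr(1)) (use q in auto)
  also have "\<dots> = of_real (2 * pi * cos_mean q)"
    using q by (subst integral_circle_cos_powr(2)) auto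
  finally have "L 1 = of_real (c * cos_mean q)"
    by (simp add: L_def)
  then have "norm (L 1) = c * cos_mean q"
    using c cos_mean_pos[OF q] by (simp add: abs_mult norm_mult)
  moreover have "norm (L 1) \<le> onorm L * norm (1::complex)"
    by (rule onorm[OF has_derivative_bounded_linear[OF L]])
  ultimately show ?thesis
    by (simp add: Dnorm0_eq_onorm[OF L] c_def)
qed

theorem theorem2:
  fixes \<alpha> :: real and p :: ereal
  assumes "\<alpha> > -1" and "1 < p"
  shows "(\<forall>g. in_Lp p g \<longrightarrow>
            P_alpha \<alpha> g differentiable (at 0) \<and>
            Dnorm0 (P_alpha \<alpha> g) \<le> sharp_const \<alpha> (conj_exp p) * Lp_norm p g)
       \<and> (\<forall>C < sharp_const \<alpha> (conj_exp p). \<exists>g. in_Lp p g \<and>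
            Dnorm0 (P_alpha \<alpha> g) > C * Lp_norm p g)"
proof (intro conjI allI impI)
  fix g assume g: "in_Lp p g"
  show "P_alpha \<alpha> g differentiable (at 0)"
    using P_alpha_has_derivative_0[OF in_Lp_integrable[OF g assms(2)]] by (rule differentiableI)
  show "Dnorm0 (P_alpha \<alpha> g) \<le> sharp_const \<alpha> (conj_exp p) * Lp_norm p g"
    by (rule Dnorm0_P_alpha_le[OF assms g])
next
  fix C assume C: "C < sharp_const \<alpha> (conj_exp p)"
  define q where "q = conj_exp p"
  have q: "q > 0"
    using assms(2) by (cases p) (auto simp: q_def conj_exp_def)
  define c where "c = c_alpha \<alpha> * (\<alpha> + 2)"
  have c: "c > 0" using c_alpha_pos assms(1) by (simp add: c_def)
  \<comment> \<open>The extremal function attains the constant, so the same witness serves every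
    smaller \<open>C\<close>.\<close>
  let ?g = "extremal q" and ?N = "Lp_norm p (extremal q)"
  have Lp: "in_Lp p ?g" and N: "cos_mean q powr (1 / q) * ?N \<le> cos_mean q"
    using Lp_norm_extremal[OF assms(2)] by (simp_all add: q_def)
  have ge: "c * cos_mean q \<le> Dnorm0 (P_alpha \<alpha> ?g)"
    using Dnorm0_P_alpha_extremal_ge[OF assms(2,1)] by (simp add: c_def q_def)
  have sharp: "sharp_const \<alpha> q = c * cos_mean q powr (1 / q)"
    by (simp add: sharp_const_altdef c_def)
  \<comment> \<open>Lower and upper bound for the extremal function together force its norm to be
    positive, which makes the comparison with \<open>C\<close> strict.\<close>
  have "0 < c * cos_mean q" using c cos_mean_pos[OF q] by simp
  also have "\<dots> \<le> sharp_const \<alpha> q * ?N"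
    using ge Dnorm0_P_alpha_le[OF assms Lp] by (simp add: q_def)
  finally have "?N > 0"
    by (rule zero_less_mult_pos) (use c cos_mean_pos[OF q] in \<open>simp add: sharp\<close>)
  then have "C * ?N < sharp_const \<alpha> q * ?N"
    using C by (simp add: q_def)
  also have "\<dots> \<le> c * cos_mean q"
    using N c by (simp add: sharp mult.assoc)
  also note ge
  finally show "\<exists>g. in_Lp p g \<and> Dnorm0 (P_alpha \<alpha> g) > C * Lp_norm p g"
    using Lp by blast
qed

end
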